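(* Let $(X,\ast)$ be a rack. The following are equivalent: (1) $X$ is cocommutative. (2) $X$ is a cocommutative quandle. (3) For all $x\in X$, the left multiplication map $L_x\colon X\to X$, $y\mapsto x\ast y$, is an involution.
   Context: A magma $(X,\ast)$ is a set with a binary operation. For $x\in X$, let $R_x\colon X\to X$ be $y\mapsto y\ast x$ and $L_x\colon X\to X$ be $y\mapsto x\ast y$. A rack is a magma in which every $R_x$ is an automorphism of the magma (a bijective map preserving $\ast$). A quandle is a rack with $x\ast x=x$ for all $x$. A magma is commutative if $x\ast y=y\ast x$ for all $x,y$. The dual rack of a rack $(X,\ast)$ is $X^{\mathrm{op}}:=(X,\overline{\ast})$ with $x\mathbin{\overline{\ast}}y:=R_y^{-1}(x)$; it is again a rack. A rack $X$ is cocommutative if $X^{\mathrm{op}}$ is commutative. A map $f\colon X\to X$ is an involution if $f\circ f=\mathrm{id}_X$ (so condition (3) says $x\ast(x\ast y)=y$ for all $x,y\in X$). *)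

theory Defs
  imports "HOL-Library.FuncSet"
begin

text \<open>
  A magma is a pair of a carrier set \<open>X\<close> (possibly empty) and a binary operation \<open>m\<close> on the ambient
  type under which \<open>X\<close> is closed. The values of \<open>m\<close> outside \<open>X\<close> are irrelevant.
\<close>

definition magma :: "'a set \<Rightarrow> ('a \<Rightarrow> 'a \<Rightarrow> 'a) \<Rightarrow> bool" where
  "magma X m \<longleftrightarrow> m \<in> X \<rightarrow> X \<rightarrow> X"

definition left_mult :: "('a \<Rightarrow> 'a \<Rightarrow> 'a) \<Rightarrow> 'a \<Rightarrow> 'a \<Rightarrow> 'a" where
  "left_mult m x = (\<lambda>y. m x y)"

definition right_mult :: "('a \<Rightarrow> 'a \<Rightarrow> 'a) \<Rightarrow> 'a \<Rightarrow> 'a \<Rightarrow> 'a" where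
  "right_mult m x = (\<lambda>y. m y x)"

definition magma_automorphism :: "'a set \<Rightarrow> ('a \<Rightarrow> 'a \<Rightarrow> 'a) \<Rightarrow> ('a \<Rightarrow> 'a) \<Rightarrow> bool" where
  "magma_automorphism X m f \<longleftrightarrow>
     bij_betw f X X \<and> (\<forall>x\<in>X. \<forall>y\<in>X. f (m x y) = m (f x) (f y))"

definition rack :: "'a set \<Rightarrow> ('a \<Rightarrow> 'a \<Rightarrow> 'a) \<Rightarrow> bool" where
  "rack X m \<longleftrightarrow> magma X m \<and> (\<forall>x\<in>X. magma_automorphism X m (right_mult m x))"

definition quandle :: "'a set \<Rightarrow> ('a \<Rightarrow> 'a \<Rightarrow> 'a) \<Rightarrow> bool" where
  "quandle X m \<longleftrightarrow> rack X m \<and> (\<forall>x\<in>X. m x x = x)"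

definition commutative_magma :: "'a set \<Rightarrow> ('a \<Rightarrow> 'a \<Rightarrow> 'a) \<Rightarrow> bool" where
  "commutative_magma X m \<longleftrightarrow> magma X m \<and> (\<forall>x\<in>X. \<forall>y\<in>X. m x y = m y x)"

definition dual_mult :: "'a set \<Rightarrow> ('a \<Rightarrow> 'a \<Rightarrow> 'a) \<Rightarrow> 'a \<Rightarrow> 'a \<Rightarrow> 'a" where
  "dual_mult X m x y = inv_into X (right_mult m y) x"

definition cocommutative :: "'a set \<Rightarrow> ('a \<Rightarrow> 'a \<Rightarrow> 'a) \<Rightarrow> bool" where
  "cocommutative X m \<longleftrightarrow> rack X m \<and> commutative_magma X (dual_mult X m)"

definition involution_on :: "'a set \<Rightarrow> ('a \<Rightarrow> 'a) \<Rightarrow> bool" where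
  "involution_on X f \<longleftrightarrow> f \<in> X \<rightarrow> X \<and> (\<forall>x\<in>X. f (f x) = x)"

end

theory Submission
  imports Defs
begin

text \<open>
  Write \<open>x \<ast> y\<close> for \<open>m x y\<close>. The dual product of \<open>x\<close> and \<open>y\<close> is the unique \<open>z\<close> with \<open>z \<ast> y = x\<close>,
  so cocommutativity says that \<open>z \<ast> y = x\<close> and \<open>z \<ast> x = y\<close> have the same solutions \<open>z\<close>.
  Read with \<open>z\<close> and \<open>y\<close> given and \<open>x = z \<ast> y\<close>, this is exactly \<open>z \<ast> (z \<ast> y) = y\<close>, which is the
  equivalence with involutivity of the left multiplications
  (\<open>cocommutative_iff_left_involutive\<close>).

  In every rack, \<open>x \<ast> x\<close> acts from the right in the same way as \<open>x\<close>
  (\<open>rack_right_mult_square\<close>), so \<open>x \<ast> (x \<ast> x) = x \<ast> x\<close>. If \<open>L\<^sub>x\<close> is an involution, the left-hand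
  side is also \<open>x\<close>. Hence cocommutativity forces idempotence.
\<close>

lemma rack_closed:
  assumes "rack X m" "x \<in> X" "y \<in> X"
  shows "m x y \<in> X"
  using assms unfolding rack_def magma_def by blast

lemma rack_bij_betw:
  assumes "rack X m" "y \<in> X"
  shows "bij_betw (right_mult m y) X X"
  using assms unfolding rack_def magma_automorphism_def by blast

lemma rack_self_distrib:
  assumes "rack X m" "x \<in> X" "y \<in> X" "z \<in> X"
  shows "m (m x y) z = m (m x z) (m y z)"
  using assms unfolding rack_def magma_automorphism_def right_mult_def by blast

lemma dual_mult_closed:
  assumes "rack X m" "x \<in> X" "y \<in> X"
  shows "dual_mult X m x y \<in> X"
  using bij_betw_apply[OF bij_betw_inv_into[OF rack_bij_betw[OF assms(1,3)]] assms(2)]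
  by (simp add: dual_mult_def)

lemma dual_mult_eq_iff:
  assumes "rack X m" "x \<in> X" "y \<in> X" "z \<in> X"
  shows "dual_mult X m x y = z \<longleftrightarrow> m z y = x"
proof
  have bij: "bij_betw (right_mult m y) X X"
    by (rule rack_bij_betw[OF assms(1,3)])
  show "m z y = x" if "dual_mult X m x y = z"
    using bij_betw_inv_into_right[OF bij assms(2)] that
    by (simp add: dual_mult_def right_mult_def)
  show "dual_mult X m x y = z" if "m z y = x"
    using bij_betw_inv_into_left[OF bij assms(4)] that
    by (simp add: dual_mult_def right_mult_def)
qed

lemma cocommutative_iff_left_involutive:
  assumes rack: "rack X m"
  shows "cocommutative X m \<longleftrightarrow> (\<forall>x\<in>X. involution_on X (left_mult m x))"
proof
  assume "cocommutative X m"
  then have comm: "dual_mult X m x y = dual_mult X m y x" if "x \<in> X" "y \<in> X" for x y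
    using that unfolding cocommutative_def commutative_magma_def by blast
  have "m z (m z y) = y" if z: "z \<in> X" and y: "y \<in> X" for z y
  proof -
    have zy: "m z y \<in> X"
      by (rule rack_closed[OF rack z y])
    have "dual_mult X m (m z y) y = z"
      by (simp add: dual_mult_eq_iff[OF rack zy y z])
    then have "dual_mult X m y (m z y) = z"
      by (simp add: comm[OF y zy])
    then show ?thesis
      by (simp add: dual_mult_eq_iff[OF rack y zy z])
  qed
  then show "\<forall>x\<in>X. involution_on X (left_mult m x)"
    by (auto simp: involution_on_def left_mult_def intro: rack_closed[OF rack])
next
  assume "\<forall>x\<in>X. involution_on X (left_mult m x)"
  then have inv: "m x (m x y) = y" if "x \<in> X" "y \<in> X" for x y
    using that by (simp add: involution_on_def left_mult_def)
  have "dual_mult X m x y = dual_mult X m y x" if x: "x \<in> X" and y: "y \<in> X" for x y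
  proof -
    define z where "z = dual_mult X m x y"
    have z: "z \<in> X"
      unfolding z_def by (rule dual_mult_closed[OF rack x y])
    have "m z y = x"
      using dual_mult_eq_iff[OF rack x y z] z_def by simp
    then have "m z x = y"
      using inv[OF z y] by simp
    then have "dual_mult X m y x = z"
      by (simp add: dual_mult_eq_iff[OF rack y x z])
    then show ?thesis
      by (simp add: z_def)
  qed
  then show "cocommutative X m"
    using rack dual_mult_closed[OF rack]
    by (auto simp: cocommutative_def commutative_magma_def magma_def)
qed

text \<open>
  Self-distributivity gives \<open>(w \<ast> x) \<ast> (x \<ast> x) = (w \<ast> x) \<ast> x\<close>, and every \<open>y\<close> has the form
  \<open>w \<ast> x\<close> because \<open>R\<^sub>x\<close> is surjective.
\<close>

lemma rack_right_mult_square: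
  assumes rack: "rack X m" and x: "x \<in> X" and y: "y \<in> X"
  shows "m y (m x x) = m y x"
proof -
  obtain w where w: "w \<in> X" and "y = m w x"
    using bij_betw_imp_surj_on[OF rack_bij_betw[OF rack x]] y
    by (auto simp: right_mult_def)
  then show ?thesis
    using rack_self_distrib[OF rack w x x] by simp
qed

lemma left_involutive_rack_is_quandle:
  assumes rack: "rack X m" and inv: "\<forall>x\<in>X. involution_on X (left_mult m x)"
  shows "quandle X m"
proof -
  have "m x x = x" if x: "x \<in> X" for x
  proof -
    have "m x x = m x (m x x)"
      by (rule rack_right_mult_square[OF rack x x, symmetric])
    also have "\<dots> = x"
      using inv x by (simp add: involution_on_def left_mult_def)
    finally show ?thesis .
  qed
  then show ?thesis
    using rack by (simp add: quandle_def)
qed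

theorem theorem3p1:
  fixes X :: "'a set" and m :: "'a \<Rightarrow> 'a \<Rightarrow> 'a"
  assumes "rack X m"
  shows "(cocommutative X m \<longleftrightarrow> quandle X m \<and> cocommutative X m) \<and>
         (cocommutative X m \<longleftrightarrow> (\<forall>x\<in>X. involution_on X (left_mult m x)))"
  using cocommutative_iff_left_involutive[OF assms] left_involutive_rack_is_quandle[OF assms]
  by blast

end
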